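(* Let $\mathcal{T}=(Q,\Sigma,\delta)$ be a $G$-automaton, let $u\in\Sigma^*$ and let $n=|Q^*\circ u|$. Then $u$ is expandable with respect to $\mathcal{T}$ if and only if it is expandable by some $x\in\Sigma^*$ with $$|x|<(2\,|Q|)^{2n}.$$
   Context: An alphabet is a non-empty finite set; $\Sigma^*$ is the set of finite words over $\Sigma$, including the empty word $\varepsilon$; $|x|$ is the length of $x$. An automaton is a triple $\mathcal{T}=(Q,\Sigma,\delta)$ with a finite set $Q$ of states, an alphabet $\Sigma$ and $\delta\subseteq Q\times\Sigma\times\Sigma\times Q$; a transition $(q,a,b,p)$ goes from $q$ to $p$, reads $a$ and outputs $b$. A $G$-automaton is an automaton such that for all $q\in Q$ and $a\in\Sigma$ there is exactly one transition of the form $(q,a,b,p)\in\delta$ (complete and deterministic), and for all $q\in Q$ and $b\in\Sigma$ there is at most one transition of the form $(q,a,b,p)\in\delta$ (invertible, i.e. the automaton obtained by swapping inputs and outputs is deterministic). Each $q\in Q$ induces a length-preserving bijection $q\circ\colon\Sigma^*\to\Sigma^*$ mapping $u$ to the output of the unique run starting in $q$ with input $u$. For $\boldsymbol q=q_\ell\dots q_1\in Q^*$, $\boldsymbol q\circ$ is the composition applying $q_1\circ$ first and $q_\ell\circ$ last; $\varepsilon\circ$ is the identity. The orbit of $u$ is $Q^*\circ u=\{\boldsymbol q\circ u\mid\boldsymbol q\in Q^*\}$. The word $u$ is expandable by $x\in\Sigma^*$ (with respect to $\mathcal{T}$) if $|Q^*\circ ux|>|Q^*\circ u|$ (i.e.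 the difference is at least $k$ for some $k\ge1$), and expandable if it is expandable by some $x\in\Sigma^*$. *)

theory Defs
  imports Main
begin

definition automaton :: "'q set \<Rightarrow> 'a set \<Rightarrow> ('q \<times> 'a \<times> 'a \<times> 'q) set \<Rightarrow> bool" where
  "automaton Q \<Sigma> \<delta> \<longleftrightarrow>
     finite Q \<and> finite \<Sigma> \<and> \<Sigma> \<noteq> {} \<and> \<delta> \<subseteq> Q \<times> \<Sigma> \<times> \<Sigma> \<times> Q"

definition G_automaton :: "'q set \<Rightarrow> 'a set \<Rightarrow> ('q \<times> 'a \<times> 'a \<times> 'q) set \<Rightarrow> bool" where
  "G_automaton Q \<Sigma> \<delta> \<longleftrightarrow>
     automaton Q \<Sigma> \<delta> \<and>
     (\<forall>q\<in>Q. \<forall>a\<in>\<Sigma>. \<exists>!t. t \<in> \<delta> \<and> (\<exists>b p. t = (q, a, b, p))) \<and>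
     (\<forall>q\<in>Q. \<forall>b\<in>\<Sigma>. \<exists>\<^sub>\<le>\<^sub>1t. t \<in> \<delta> \<and> (\<exists>a p. t = (q, a, b, p)))"

text \<open>\<open>run \<delta> q u v p\<close>: there is a run from \<open>q\<close> to \<open>p\<close> with input \<open>u\<close> and output \<open>v\<close>.
  Words are read from the left, i.e. starting with the head of the list.\<close>

inductive run :: "('q \<times> 'a \<times> 'a \<times> 'q) set \<Rightarrow> 'q \<Rightarrow> 'a list \<Rightarrow> 'a list \<Rightarrow> 'q \<Rightarrow> bool"
  for \<delta> where
  empty: "run \<delta> q [] [] q"
| step: "(q, a, b, r) \<in> \<delta> \<Longrightarrow> run \<delta> r u v p \<Longrightarrow> run \<delta> q (a # u) (b # v) p"

text \<open>The output of the unique run. The description is meaningful for \<open>q \<in> Q\<close> and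
  \<open>u \<in> lists \<Sigma>\<close> in a complete and deterministic automaton, and is only used there.\<close>

definition act :: "('q \<times> 'a \<times> 'a \<times> 'q) set \<Rightarrow> 'q \<Rightarrow> 'a list \<Rightarrow> 'a list" where
  "act \<delta> q u = (THE v. \<exists>p. run \<delta> q u v p)"

text \<open>A state sequence \<open>q\<^sub>l \<dots> q\<^sub>1\<close> is the list \<open>[q\<^sub>l, \<dots>, q\<^sub>1]\<close>; as \<open>foldr\<close> starts with the
  last list element, \<open>q\<^sub>1\<close> acts first and \<open>q\<^sub>l\<close> acts last.\<close>

definition act_seq :: "('q \<times> 'a \<times> 'a \<times> 'q) set \<Rightarrow> 'q list \<Rightarrow> 'a list \<Rightarrow> 'a list" where
  "act_seq \<delta> qs u = foldr (act \<delta>) qs u"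

definition orbit :: "'q set \<Rightarrow> ('q \<times> 'a \<times> 'a \<times> 'q) set \<Rightarrow> 'a list \<Rightarrow> 'a list set" where
  "orbit Q \<delta> u = {act_seq \<delta> qs u | qs. qs \<in> lists Q}"

text \<open>Orbits of words over the finite alphabet of a G-automaton are finite, since all their
  elements have the same length, so \<open>card\<close> is the true cardinality.\<close>

definition expandable_by ::
  "'q set \<Rightarrow> ('q \<times> 'a \<times> 'a \<times> 'q) set \<Rightarrow> 'a list \<Rightarrow> 'a list \<Rightarrow> bool" where
  "expandable_by Q \<delta> u x \<longleftrightarrow> card (orbit Q \<delta> (u @ x)) > card (orbit Q \<delta> u)"

definition expandable ::
  "'q set \<Rightarrow> 'a set \<Rightarrow> ('q \<times> 'a \<times> 'a \<times> 'q) set \<Rightarrow> 'a list \<Rightarrow> bool" where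
  "expandable Q \<Sigma> \<delta> u \<longleftrightarrow> (\<exists>x\<in>lists \<Sigma>. expandable_by Q \<delta> u x)"

end

theory Submission
  imports Defs
begin

text \<open>Every element of the orbit of \<open>u\<close> is reached by a state sequence shorter than \<open>n\<close>. Fixing one
  such sequence for each element (a spanning tree of the orbital graph), \<open>u\<close> is expandable by \<open>x\<close>
  only if the tree fails to describe the orbit of \<open>u x\<close> as well: there are state sequences of length
  at most \<open>n\<close> which agree on \<open>u\<close> but not on \<open>u x\<close>. Their sections at \<open>u\<close> are then distinguished by
  \<open>x\<close>, and by pigeonhole on the pairs of sections visited, a shortest distinguishing word has length at
  most \<open>|Q|^(2n)\<close>. Working with pairs of positive sequences avoids inverse automata.\<close>

locale complete_automaton =
  fixes Q :: "'q set" and \<Sigma> :: "'a set" and \<delta> :: "('q \<times> 'a \<times> 'a \<times> 'q) set"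
  assumes automaton: "automaton Q \<Sigma> \<delta>"
    and ex1_transition: "q \<in> Q \<Longrightarrow> a \<in> \<Sigma> \<Longrightarrow> \<exists>!t. t \<in> \<delta> \<and> (\<exists>b p. t = (q, a, b, p))"
begin

lemma finite_states: "finite Q" and finite_alphabet: "finite \<Sigma>"
  and transitions: "\<delta> \<subseteq> Q \<times> \<Sigma> \<times> \<Sigma> \<times> Q"
  using automaton by (auto simp: automaton_def)

section \<open>Runs, actions of state sequences, and sections\<close>

lemma run_exists:
  assumes "u \<in> lists \<Sigma>" "q \<in> Q"
  shows "\<exists>v p. run \<delta> q u v p \<and> v \<in> lists \<Sigma> \<and> p \<in> Q \<and> length v = length u"
  using assms
proof (induction u arbitrary: q)
  case Nil
  then show ?case by (auto intro: run.empty)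
next
  case (Cons a u)
  then obtain b r where t: "(q, a, b, r) \<in> \<delta>"
    using ex1_transition[of q a] by auto
  then have "r \<in> Q" "b \<in> \<Sigma>" using transitions by auto
  then obtain v p where "run \<delta> r u v p" "v \<in> lists \<Sigma>" "p \<in> Q" "length v = length u"
    using Cons by blast
  then show ?case using run.step[OF t] \<open>b \<in> \<Sigma>\<close> by (intro exI[of _ "b # v"] exI[of _ p]) auto
qed

lemma run_unique:
  assumes "run \<delta> q u v p" "run \<delta> q u v' p'"
  shows "v = v' \<and> p = p'"
  using assms
proof (induction arbitrary: v' p' rule: run.induct)
  case (empty q)
  then show ?case by (auto elim: run.cases)
next
  case (step q a b r u v p)
  from step.prems obtain b' r' w where
    w: "v' = b' # w" "(q, a, b', r') \<in> \<delta>" "run \<delta> r' u w p'"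
    by (auto elim: run.cases)
  have "q \<in> Q" "a \<in> \<Sigma>" using step.hyps(1) transitions by auto
  then have "(b, r) = (b', r')"
    using ex1_transition[of q a] step.hyps(1) w(2) by blast
  then show ?case using step.IH w by auto
qed

lemma run_append:
  assumes "run \<delta> q u v r" "run \<delta> r x y p"
  shows "run \<delta> q (u @ x) (v @ y) p"
  using assms by (induction rule: run.induct) (auto intro: run.step)

definition target :: "'q \<Rightarrow> 'a list \<Rightarrow> 'q" where
  "target q u = (THE p. \<exists>v. run \<delta> q u v p)"

lemma act_target_eqI:
  assumes "run \<delta> q u v p"
  shows "act \<delta> q u = v" "target q u = p"
  using run_unique[OF assms] assms unfolding act_def target_def by (blast intro: the_equality)+

lemma run_act_target:
  assumes "u \<in> lists \<Sigma>" "q \<in> Q"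
  shows "run \<delta> q u (act \<delta> q u) (target q u)"
  using run_exists[OF assms] act_target_eqI by metis

lemma act_in_lists: "u \<in> lists \<Sigma> \<Longrightarrow> q \<in> Q \<Longrightarrow> act \<delta> q u \<in> lists \<Sigma>"
  and target_in_states: "u \<in> lists \<Sigma> \<Longrightarrow> q \<in> Q \<Longrightarrow> target q u \<in> Q"
  and length_act: "u \<in> lists \<Sigma> \<Longrightarrow> q \<in> Q \<Longrightarrow> length (act \<delta> q u) = length u"
  using run_exists act_target_eqI by metis+

lemma act_append:
  assumes "u \<in> lists \<Sigma>" "x \<in> lists \<Sigma>" "q \<in> Q"
  shows "act \<delta> q (u @ x) = act \<delta> q u @ act \<delta> (target q u) x"
  using run_append[OF run_act_target run_act_target, of u q x] assms
  by (simp add: act_target_eqI target_in_states)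

text \<open>The state sequence that acts on what follows \<open>u\<close>. States further right act
  first, so \<open>q\<close> reads \<open>act_seq \<delta> qs u\<close> and not \<open>u\<close>
  itself.\<close>

fun section_seq :: "'q list \<Rightarrow> 'a list \<Rightarrow> 'q list" where
  "section_seq [] u = []"
| "section_seq (q # qs) u = target q (act_seq \<delta> qs u) # section_seq qs u"

lemma act_seq_simps [simp]:
  "act_seq \<delta> [] u = u" "act_seq \<delta> (q # qs) u = act \<delta> q (act_seq \<delta> qs u)"
  by (simp_all add: act_seq_def)

lemma act_seq_append_seq: "act_seq \<delta> (ps @ qs) u = act_seq \<delta> ps (act_seq \<delta> qs u)"
  by (simp add: act_seq_def)

lemma act_seq_in_lists: "qs \<in> lists Q \<Longrightarrow> u \<in> lists \<Sigma> \<Longrightarrow> act_seq \<delta> qs u \<in> lists \<Sigma>"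
  by (induction qs) (auto simp del: in_lists_conv_set simp: act_in_lists)

lemma length_act_seq: "qs \<in> lists Q \<Longrightarrow> u \<in> lists \<Sigma> \<Longrightarrow> length (act_seq \<delta> qs u) = length u"
  by (induction qs) (auto simp del: in_lists_conv_set simp: length_act act_seq_in_lists)

lemma section_seq_in_lists:
  "qs \<in> lists Q \<Longrightarrow> u \<in> lists \<Sigma> \<Longrightarrow> section_seq qs u \<in> lists Q"
  by (induction qs) (auto simp del: in_lists_conv_set simp: target_in_states act_seq_in_lists)

lemma length_section_seq [simp]: "length (section_seq qs u) = length qs"
  by (induction qs) auto

lemma act_seq_append:
  assumes "qs \<in> lists Q" "u \<in> lists \<Sigma>" "x \<in> lists \<Sigma>"
  shows "act_seq \<delta> qs (u @ x) = act_seq \<delta> qs u @ act_seq \<delta> (section_seq qs u) x"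
  using assms
  by (induction qs)
    (auto simp del: in_lists_conv_set simp: act_append act_seq_in_lists section_seq_in_lists)

text \<open>Proper prefixes of a shortest distinguishing word distinguish nothing, so if two of them
  led to the same pair of sections, the factor between them could be cut out. The bound counts the
  possible pairs.\<close>

lemma short_distinguishing_word:
  assumes ps: "ps \<in> lists Q" and rs: "rs \<in> lists Q"
    and x: "x \<in> lists \<Sigma>" "act_seq \<delta> ps x \<noteq> act_seq \<delta> rs x"
  shows "\<exists>y\<in>lists \<Sigma>. act_seq \<delta> ps y \<noteq> act_seq \<delta> rs y \<and>
    length y \<le> card Q ^ (length ps + length rs)"
proof -
  define D where "D y \<longleftrightarrow> y \<in> lists \<Sigma> \<and> act_seq \<delta> ps y \<noteq> act_seq \<delta> rs y" for y
  have "D x" using x by (simp add: D_def)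
  then obtain y where y: "D y" and min: "\<And>z. D z \<Longrightarrow> length y \<le> length z"
    using ex_has_least_nat[of D x length] by blast
  then have y_in: "y \<in> lists \<Sigma>" by (simp add: D_def)
  have take_in: "take i y \<in> lists \<Sigma>" and drop_in: "drop i y \<in> lists \<Sigma>" for i
    using y_in by (auto dest: in_set_takeD in_set_dropD)
  let ?pair = "\<lambda>i. (section_seq ps (take i y), section_seq rs (take i y))"
  let ?P = "{qs. set qs \<subseteq> Q \<and> length qs = length ps} \<times> {qs. set qs \<subseteq> Q \<and> length qs = length rs}"
  have eq_take: "act_seq \<delta> ps (take i y) = act_seq \<delta> rs (take i y)" if "i < length y" for i
  proof (rule ccontr)
    assume "\<not> ?thesis"
    then have "D (take i y)" using take_in by (simp add: D_def del: in_lists_conv_set)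
    then show False using min that by fastforce
  qed
  have "?pair i \<noteq> ?pair j" if ij: "i < j" "j < length y" for i j
  proof
    assume pair: "?pair i = ?pair j"
    have "act_seq \<delta> qs y = act_seq \<delta> qs (take j y) @ act_seq \<delta> (section_seq qs (take j y)) (drop j y)"
      if "qs \<in> lists Q" for qs
      using act_seq_append[OF that take_in[of j] drop_in[of j]] by simp
    then have "act_seq \<delta> (section_seq ps (take j y)) (drop j y)
        \<noteq> act_seq \<delta> (section_seq rs (take j y)) (drop j y)"
      using y ps rs eq_take[OF ij(2)] unfolding D_def by metis
    \<comment> \<open>Equal pairs of sections let the suffix from \<open>j\<close> on continue the
      shorter prefix, with the outputs still different.\<close>
    then have "act_seq \<delta> ps (take i y @ drop j y) \<noteq> act_seq \<delta> rs (take i y @ drop j y)"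
      using pair eq_take[of i] ij act_seq_append[OF ps take_in[of i] drop_in[of j]]
        act_seq_append[OF rs take_in[of i] drop_in[of j]] by simp
    then have "D (take i y @ drop j y)"
      using take_in[of i] drop_in[of j] by (simp add: D_def)
    then show False using min[of "take i y @ drop j y"] ij by simp
  qed
  \<comment> \<open>Only proper prefixes take part, since \<open>y\<close> itself does distinguish;
    hence there are \<open>length y\<close> pairs and the bound is non-strict.\<close>
  then have "inj_on ?pair {..<length y}"
    by (intro linorder_inj_onI) auto
  moreover have "?pair ` {..<length y} \<subseteq> ?P"
    using section_seq_in_lists[OF ps take_in] section_seq_in_lists[OF rs take_in] by fastforce
  moreover have "finite ?P"
    using finite_lists_length_eq[OF finite_states] by blast
  ultimately have "length y \<le> card ?P"
    using card_inj_on_le[of ?pair "{..<length y}" ?P] by simp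
  also have "card ?P = card Q ^ (length ps + length rs)"
    using card_lists_length_eq[OF finite_states] by (simp add: card_cartesian_product power_add)
  finally show ?thesis using y unfolding D_def by blast
qed

section \<open>Orbits and expandability\<close>

lemma finite_orbit:
  assumes "u \<in> lists \<Sigma>"
  shows "finite (orbit Q \<delta> u)"
proof (rule finite_subset)
  show "orbit Q \<delta> u \<subseteq> {v. set v \<subseteq> \<Sigma> \<and> length v = length u}"
    using act_seq_in_lists length_act_seq assms unfolding orbit_def by fastforce
qed (simp add: finite_lists_length_eq finite_alphabet)

lemma act_seq_in_orbit: "qs \<in> lists Q \<Longrightarrow> act_seq \<delta> qs u \<in> orbit Q \<delta> u"
  unfolding orbit_def by blast

text \<open>A shortest sequence leading from \<open>u\<close> to \<open>v\<close> visits no orbit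
  element twice, as a cycle could be cut out.\<close>

lemma orbit_short_seq:
  assumes u: "u \<in> lists \<Sigma>" and v: "v \<in> orbit Q \<delta> u"
  shows "\<exists>qs\<in>lists Q. act_seq \<delta> qs u = v \<and> length qs < card (orbit Q \<delta> u)"
proof -
  define R where "R qs \<longleftrightarrow> qs \<in> lists Q \<and> act_seq \<delta> qs u = v" for qs
  obtain ps where "R ps" using v unfolding orbit_def R_def by blast
  then obtain qs where qs: "R qs" and min: "\<And>rs. R rs \<Longrightarrow> length qs \<le> length rs"
    using ex_has_least_nat[of R ps length] by blast
  then have qs_in: "qs \<in> lists Q" by (simp add: R_def)
  \<comment> \<open>The last entry acts first, so \<open>?f\<close> follows the path backwards: it
    is \<open>u\<close> at \<open>i = length qs\<close> and \<open>v\<close> at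
    \<open>i = 0\<close>.\<close>
  let ?f = "\<lambda>i. act_seq \<delta> (drop i qs) u"
  have "?f i \<noteq> ?f j" if ij: "i < j" "j \<le> length qs" for i j
  proof
    assume "?f i = ?f j"
    then have "act_seq \<delta> (take i qs @ drop j qs) u = act_seq \<delta> (take i qs @ drop i qs) u"
      unfolding act_seq_append_seq by simp
    then have "R (take i qs @ drop j qs)"
      using qs by (auto simp: R_def dest: in_set_takeD in_set_dropD)
    then show False using min[of "take i qs @ drop j qs"] ij by simp
  qed
  \<comment> \<open>Both ends of the path count: \<open>length qs + 1\<close> distinct elements give
    the strict bound.\<close>
  then have "inj_on ?f {..length qs}"
    by (intro linorder_inj_onI) auto
  moreover have "?f ` {..length qs} \<subseteq> orbit Q \<delta> u"
    using qs_in by (auto intro!: act_seq_in_orbit dest: in_set_dropD)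
  ultimately have "card {..length qs} \<le> card (orbit Q \<delta> u)"
    using card_inj_on_le finite_orbit[OF u] by blast
  then show ?thesis using qs unfolding R_def by auto
qed

text \<open>Truncation to \<open>length u\<close> maps the orbit of \<open>u @ x\<close> onto the
  orbit of \<open>u\<close>. The two sequences witness that it is not injective, so the first orbit
  is strictly larger.\<close>

lemma expandable_byI:
  assumes u: "u \<in> lists \<Sigma>" and x: "x \<in> lists \<Sigma>" and ps: "ps \<in> lists Q" and rs: "rs \<in> lists Q"
    and eq: "act_seq \<delta> ps u = act_seq \<delta> rs u"
    and neq: "act_seq \<delta> ps (u @ x) \<noteq> act_seq \<delta> rs (u @ x)"
  shows "expandable_by Q \<delta> u x"
proof -
  let ?O = "orbit Q \<delta> (u @ x)" and ?f = "take (length u)"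
  have prefix: "?f (act_seq \<delta> qs (u @ x)) = act_seq \<delta> qs u" if "qs \<in> lists Q" for qs
    using act_seq_append[OF that u x] length_act_seq[OF that u] by simp
  then have image: "?f ` ?O = orbit Q \<delta> u"
    unfolding orbit_def by (fastforce simp: image_iff)
  have finite: "finite ?O" using u x by (intro finite_orbit) auto
  have "\<not> inj_on ?f ?O"
    using act_seq_in_orbit[OF ps, of "u @ x"] act_seq_in_orbit[OF rs, of "u @ x"]
      prefix[OF ps] prefix[OF rs] eq neq unfolding inj_on_def by metis
  then have "card (?f ` ?O) < card ?O"
    using card_image_le[OF finite, of ?f] eq_card_imp_inj_on[OF finite, of ?f] by linarith
  then show ?thesis unfolding expandable_by_def image .
qed

text \<open>If all such sequences agreed on \<open>u @ x\<close>, each element of the orbit of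
  \<open>u\<close> would have a single extension, given by its chosen sequence, and the orbit could
  not grow. The non-strict length bound accommodates a chosen sequence with one more state in
  front.\<close>

lemma expandable_by_short_seqs:
  assumes u: "u \<in> lists \<Sigma>" and exp: "expandable_by Q \<delta> u x"
  shows "\<exists>ps\<in>lists Q. \<exists>rs\<in>lists Q.
    length ps \<le> card (orbit Q \<delta> u) \<and> length rs \<le> card (orbit Q \<delta> u) \<and>
    act_seq \<delta> ps u = act_seq \<delta> rs u \<and> act_seq \<delta> ps (u @ x) \<noteq> act_seq \<delta> rs (u @ x)"
proof (rule ccontr)
  assume "\<not> ?thesis"
  then have agree: "act_seq \<delta> ps (u @ x) = act_seq \<delta> rs (u @ x)"
    if "ps \<in> lists Q" "rs \<in> lists Q"
      "length ps \<le> card (orbit Q \<delta> u)" "length rs \<le> card (orbit Q \<delta> u)"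
      "act_seq \<delta> ps u = act_seq \<delta> rs u" for ps rs
    using that by blast
  obtain t where t: "\<And>v. v \<in> orbit Q \<delta> u \<Longrightarrow>
      t v \<in> lists Q \<and> act_seq \<delta> (t v) u = v \<and> length (t v) < card (orbit Q \<delta> u)"
    using orbit_short_seq[OF u] by metis
  have tree: "act_seq \<delta> qs (u @ x) = act_seq \<delta> (t (act_seq \<delta> qs u)) (u @ x)"
    if "qs \<in> lists Q" for qs
    using that
  proof (induction qs)
    case Nil
    have "act_seq \<delta> [] u \<in> orbit Q \<delta> u" by (rule act_seq_in_orbit) simp
    \<comment> \<open>The sequence chosen for \<open>u\<close> itself may be non-empty, so
      \<open>agree\<close> has to compare it with \<open>[]\<close>.\<close>
    from t[OF this] show ?case by (intro agree) auto
  next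
    case (Cons q qs)
    let ?v = "act_seq \<delta> qs u"
    have in_orbit: "?v \<in> orbit Q \<delta> u" "act_seq \<delta> (q # qs) u \<in> orbit Q \<delta> u"
      using Cons.hyps act_seq_in_orbit[of qs u] act_seq_in_orbit[of "q # qs" u] by auto
    have "act_seq \<delta> (q # qs) (u @ x) = act_seq \<delta> (q # t ?v) (u @ x)"
      using Cons by simp
    \<comment> \<open>Both sequences take \<open>u\<close> to the same element. As
      \<open>t ?v\<close> is strictly shorter than the bound, \<open>q # t ?v\<close> still
      satisfies it.\<close>
    also have "\<dots> = act_seq \<delta> (t (act_seq \<delta> (q # qs) u)) (u @ x)"
      using t[OF in_orbit(1)] t[OF in_orbit(2)] Cons.hyps by (intro agree) auto
    finally show ?case .
  qed
  then have "orbit Q \<delta> (u @ x) \<subseteq> (\<lambda>v. act_seq \<delta> (t v) (u @ x)) ` orbit Q \<delta> u"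
    unfolding orbit_def by blast
  then have "card (orbit Q \<delta> (u @ x)) \<le> card (orbit Q \<delta> u)"
    using surj_card_le[OF finite_orbit[OF u]] by blast
  then show False using exp by (simp add: expandable_by_def)
qed

text \<open>The exponent bounds the total length of two sections, each as long as one of the short
  sequences.\<close>

lemma expandable_by_short_word:
  assumes u: "u \<in> lists \<Sigma>" and x: "x \<in> lists \<Sigma>" and exp: "expandable_by Q \<delta> u x"
  shows "\<exists>y\<in>lists \<Sigma>. length y < (2 * card Q) ^ (2 * card (orbit Q \<delta> u)) \<and> expandable_by Q \<delta> u y"
proof -
  let ?n = "card (orbit Q \<delta> u)"
  obtain ps rs where ps: "ps \<in> lists Q" "length ps \<le> ?n" and rs: "rs \<in> lists Q" "length rs \<le> ?n"
    and eq: "act_seq \<delta> ps u = act_seq \<delta> rs u"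
    and neq: "act_seq \<delta> ps (u @ x) \<noteq> act_seq \<delta> rs (u @ x)"
    using expandable_by_short_seqs[OF u exp] by metis
  \<comment> \<open>The outputs on \<open>u\<close> coincide, so the difference arises on
    \<open>x\<close>, through the sections.\<close>
  have "act_seq \<delta> (section_seq ps u) x \<noteq> act_seq \<delta> (section_seq rs u) x"
    using eq neq act_seq_append[OF ps(1) u x] act_seq_append[OF rs(1) u x] by auto
  from short_distinguishing_word[OF section_seq_in_lists[OF ps(1) u]
      section_seq_in_lists[OF rs(1) u] x this]
  obtain y where y: "y \<in> lists \<Sigma>"
    "act_seq \<delta> (section_seq ps u) y \<noteq> act_seq \<delta> (section_seq rs u) y"
    "length y \<le> card Q ^ (length ps + length rs)"
    by auto
  have "act_seq \<delta> ps (u @ y) \<noteq> act_seq \<delta> rs (u @ y)"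
    using eq y(2) act_seq_append[OF ps(1) u y(1)] act_seq_append[OF rs(1) u y(1)] by auto
  then have exp_y: "expandable_by Q \<delta> u y"
    by (rule expandable_byI[OF u y(1) ps(1) rs(1) eq])
  \<comment> \<open>Over an empty \<open>Q\<close> both sequences would be \<open>[]\<close> and
    could not differ.\<close>
  have "Q \<noteq> {}" using ps(1) rs(1) neq by auto
  then have Q_pos: "card Q > 0" using finite_states by (simp add: card_gt_0_iff)
  have "?n > 0"
    using act_seq_in_orbit[of "[]" u] finite_orbit[OF u] by (auto simp: card_gt_0_iff)
  then have "(1::nat) < 2 ^ (2 * ?n)" by (intro one_less_power) auto
  have "length y \<le> card Q ^ (2 * ?n)"
    using y(3) power_increasing[of "length ps + length rs" "2 * ?n" "card Q"] ps(2) rs(2) Q_pos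
    by linarith
  \<comment> \<open>The factor \<open>2 ^ (2 * ?n)\<close> exceeds 1 and turns the bound into a
    strict one.\<close>
  also have "\<dots> < 2 ^ (2 * ?n) * card Q ^ (2 * ?n)"
    using \<open>1 < 2 ^ (2 * ?n)\<close> Q_pos by simp
  finally show ?thesis using y(1) exp_y by (auto simp: power_mult_distrib)
qed

end

theorem corollary4p6:
  fixes Q :: "'q set" and \<Sigma> :: "'a set" and \<delta> :: "('q \<times> 'a \<times> 'a \<times> 'q) set"
    and u :: "'a list" and n :: nat
  assumes "G_automaton Q \<Sigma> \<delta>"
    and "u \<in> lists \<Sigma>"
    and "n = card (orbit Q \<delta> u)"
  shows "expandable Q \<Sigma> \<delta> u \<longleftrightarrow>
    (\<exists>x\<in>lists \<Sigma>. length x < (2 * card Q) ^ (2 * n) \<and> expandable_by Q \<delta> u x)"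
proof -
  interpret complete_automaton Q \<Sigma> \<delta>
    using assms(1) by unfold_locales (auto simp: G_automaton_def)
  show ?thesis
    using expandable_by_short_word[OF assms(2)] unfolding expandable_def assms(3) by blast
qed

end
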